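(* Let $G$ be a non-complete graph. Then for every integer $n\ge |G|$, $$\mathrm{ex}(n,G)\;\le\;\mathrm{st}(n,G)\;=\;\mathrm{ex}(n,D(G))\;\le\;\min\{\mathrm{ex}(n,H) : H\in D(G)\}.$$
   Context: Graphs are finite and simple; $|G|$ is the number of vertices of $G$. "Contains" always refers to not necessarily induced subgraphs. For a graph $G$ (or family $\mathcal F$) with edges, $\mathrm{ex}(n,G)$ (resp. $\mathrm{ex}(n,\mathcal F)$) is the maximum number of edges of a graph on $n$ vertices containing no copy of $G$ (resp. of any member of $\mathcal F$); for edgeless $G$ the quantity $\mathrm{ex}(n,G)$ is not defined and the first inequality is not asserted. For a non-complete graph $G$ on $k$ vertices and $n\ge k$, $\mathrm{st}(n,G)$ is the largest $m$ for which there is a graph $H$ with $n$ vertices and $m$ edges such that no subgraph $F\subseteq H$ on exactly $k$ vertices contains $G$ as a proper subgraph. $D(G)$ is the family of all graphs $H$ with $|H|=|G|$ obtained from $G$ by adding one new edge between two non-adjacent vertices of $G$. *)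

theory Defs
  imports Main "HOL-Library.Ramsey"
begin

datatype 'a graph = Graph (verts: "'a set") (edges: "'a set set")

definition simple_graph :: "'a graph \<Rightarrow> bool" where
  "simple_graph G \<longleftrightarrow> finite (verts G) \<and> edges G \<subseteq> nsets (verts G) 2"

definition complete_graph :: "'a graph \<Rightarrow> bool" where
  "complete_graph G \<longleftrightarrow> simple_graph G \<and> edges G = nsets (verts G) 2"

definition subgraph :: "'a graph \<Rightarrow> 'a graph \<Rightarrow> bool" where
  "subgraph F H \<longleftrightarrow> simple_graph F \<and> simple_graph H \<and>
     verts F \<subseteq> verts H \<and> edges F \<subseteq> edges H"

definition graph_isomorphic :: "'a graph \<Rightarrow> 'b graph \<Rightarrow> bool" where
  "graph_isomorphic G H \<longleftrightarrow>
     (\<exists>f. bij_betw f (verts G) (verts H) \<and> edges H = (\<lambda>e. f ` e) ` edges G)"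

definition contains :: "'b graph \<Rightarrow> 'a graph \<Rightarrow> bool" where
  "contains H G \<longleftrightarrow> (\<exists>G'. subgraph G' H \<and> graph_isomorphic G G')"

definition contains_properly :: "'b graph \<Rightarrow> 'a graph \<Rightarrow> bool" where
  "contains_properly H G \<longleftrightarrow>
     (\<exists>G'. subgraph G' H \<and> G' \<noteq> H \<and> graph_isomorphic G G')"

text \<open>
  Host graphs are taken with vertices in \<open>nat\<close>; every finite graph is isomorphic to
  such a graph. The maxima below are over finite sets of numbers. For \<open>ex_family\<close> the
  set is nonempty if every member of the family has an edge (the edgeless graph on
  \<open>n\<close> vertices avoids them all); otherwise it can be empty and the value unspecified.
  For \<open>st\<close> the set is always nonempty, again by the edgeless graph.
\<close>

definition ex_family :: "nat \<Rightarrow> 'a graph set \<Rightarrow> nat" where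
  "ex_family n \<F> = Max {card (edges H) | H :: nat graph.
     simple_graph H \<and> card (verts H) = n \<and> (\<forall>G\<in>\<F>. \<not> contains H G)}"

definition ex_graph :: "nat \<Rightarrow> 'a graph \<Rightarrow> nat" where
  "ex_graph n G = ex_family n {G}"

definition st :: "nat \<Rightarrow> 'a graph \<Rightarrow> nat" where
  "st n G = Max {card (edges H) | H :: nat graph.
     simple_graph H \<and> card (verts H) = n \<and>
     \<not> (\<exists>F. subgraph F H \<and> card (verts F) = card (verts G) \<and> contains_properly F G)}"

text \<open>
  The family \<open>D(G)\<close>, realised on the vertex set of \<open>G\<close> itself. It is not taken up to
  isomorphism, which affects neither containment nor the values of \<open>ex_graph\<close>.
\<close>

definition edge_extensions :: "'a graph \<Rightarrow> 'a graph set" where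
  "edge_extensions G =
     {Graph (verts G) (insert e (edges G)) | e. e \<in> nsets (verts G) 2 - edges G}"

end

theory Submission
  imports Defs
begin

text \<open>
  A graph \<open>F\<close> on \<open>|G|\<close> vertices that properly contains a copy of \<open>G\<close> has the same vertex set
  as that copy, hence has an additional edge; pulling this edge back to \<open>G\<close> exhibits a copy of
  some member of \<open>D(G)\<close> inside \<open>F\<close>. Conversely a copy of a member of \<open>D(G)\<close> is itself such an
  \<open>F\<close>. So the host graphs admitted for \<open>st(n,G)\<close> are exactly the \<open>D(G)\<close>-free ones
  (\<open>proper_containment_iff_contains_extension\<close>), which gives the equality. Both inequalities
  compare maxima over two classes of host graphs, one included in the other: a \<open>G\<close>-free graph is
  \<open>D(G)\<close>-free, and a \<open>D(G)\<close>-free graph is \<open>H\<close>-free for each \<open>H\<close> in \<open>D(G)\<close>. Such a comparison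
  (\<open>ex_family_mono\<close>) needs the smaller class to be nonempty; the edgeless
  graph belongs to it because the excluded graphs have edges.
\<close>

lemma simple_graph_card_edges_le:
  assumes "simple_graph H"
  shows "card (edges H) \<le> card (verts H) choose 2"
  using assms card_mono[of "nsets (verts H) 2" "edges H"]
  by (simp add: simple_graph_def finite_imp_finite_nsets)

lemma contains_iff_embedding:
  assumes "simple_graph G" "simple_graph H"
  shows "contains H G \<longleftrightarrow>
    (\<exists>f. inj_on f (verts G) \<and> f ` verts G \<subseteq> verts H \<and> (\<lambda>e. f ` e) ` edges G \<subseteq> edges H)"
    (is "_ \<longleftrightarrow> ?R")
proof
  assume "contains H G"
  then show ?R
    unfolding contains_def subgraph_def graph_isomorphic_def bij_betw_def by metis
next
  assume ?R
  then obtain f where f: "inj_on f (verts G)" "f ` verts G \<subseteq> verts H"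
    "(\<lambda>e. f ` e) ` edges G \<subseteq> edges H" by blast
  let ?G' = "Graph (f ` verts G) ((\<lambda>e. f ` e) ` edges G)"
  have "f ` e \<in> nsets (f ` verts G) 2" if "e \<in> edges G" for e
  proof -
    have "e \<subseteq> verts G" "finite e" "card e = 2"
      using that assms(1) by (auto simp: simple_graph_def nsets_def)
    then show ?thesis
      using card_image[OF inj_on_subset[OF f(1)]] by (simp add: nsets_def image_mono)
  qed
  then have "simple_graph ?G'"
    using assms(1) by (auto simp: simple_graph_def)
  then have "subgraph ?G' H"
    using f assms(2) by (simp add: subgraph_def)
  moreover have "graph_isomorphic G ?G'"
    using f(1) by (auto simp: graph_isomorphic_def bij_betw_def)
  ultimately show "contains H G"
    unfolding contains_def by blast
qed

lemma edge_extensionsE: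
  assumes "X \<in> edge_extensions G" "simple_graph G"
  obtains e where "e \<in> nsets (verts G) 2" "e \<notin> edges G" "verts X = verts G"
    "edges X = insert e (edges G)" "simple_graph X"
  using assms unfolding edge_extensions_def simple_graph_def by fastforce

lemma contains_extension_imp_contains:
  assumes "simple_graph G" "simple_graph H" "X \<in> edge_extensions G" "contains H X"
  shows "contains H G"
proof -
  obtain e where e: "verts X = verts G" "edges X = insert e (edges G)" "simple_graph X"
    using edge_extensionsE[OF assms(3,1)] by metis
  obtain f where "inj_on f (verts X)" "f ` verts X \<subseteq> verts H" "(\<lambda>e. f ` e) ` edges X \<subseteq> edges H"
    using assms(4) contains_iff_embedding[OF e(3) assms(2)] by blast
  then show ?thesis
    unfolding contains_iff_embedding[OF assms(1,2)] e(1,2) by blast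
qed

lemma proper_containment_iff_contains_extension:
  assumes G: "simple_graph G" and H: "simple_graph H"
  shows "(\<exists>F. subgraph F H \<and> card (verts F) = card (verts G) \<and> contains_properly F G) \<longleftrightarrow>
    (\<exists>X\<in>edge_extensions G. contains H X)" (is "?L \<longleftrightarrow> ?R")
proof
  assume ?L
  then obtain F G' f where F: "subgraph F H" "card (verts F) = card (verts G)"
    and G': "subgraph G' F" "G' \<noteq> F"
    and f: "bij_betw f (verts G) (verts G')" "edges G' = (\<lambda>e. f ` e) ` edges G"
    unfolding contains_properly_def graph_isomorphic_def by blast
  \<comment> \<open>Having equally many vertices, \<open>G'\<close> spans \<open>F\<close>, so it can only differ from \<open>F\<close> in an edge.\<close>
  have "card (verts G') = card (verts F)"
    using bij_betw_same_card[OF f(1)] F(2) by simp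
  then have V: "verts G' = verts F"
    using G'(1) by (intro card_subset_eq) (auto simp: subgraph_def simple_graph_def)
  then obtain e' where e': "e' \<in> edges F" "e' \<notin> edges G'"
    using G' graph.expand[of G' F] by (auto simp: subgraph_def)
  have inj: "inj_on f (verts G)" and im: "f ` verts G = verts F"
    using f(1) V by (auto simp: bij_betw_def)
  have e'2: "e' \<subseteq> f ` verts G" "finite e'" "card e' = 2"
    using e'(1) F(1) im by (auto simp: subgraph_def simple_graph_def nsets_def)
  then obtain e where e: "e \<subseteq> verts G" "e' = f ` e"
    by (meson subset_imageE)
  have inje: "inj_on f e"
    using inj e(1) by (rule inj_on_subset)
  have "e \<in> nsets (verts G) 2"
    using e e'2 card_image[OF inje] finite_image_iff[OF inje] by (simp add: nsets_def)
  moreover have "e \<notin> edges G"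
    using e'(2) e(2) f(2) by blast
  ultimately have X: "Graph (verts G) (insert e (edges G)) \<in> edge_extensions G" (is "?X \<in> _")
    unfolding edge_extensions_def by blast
  have sX: "simple_graph ?X"
    using edge_extensionsE[OF X G] by metis
  have "(\<lambda>e. f ` e) ` edges ?X \<subseteq> edges H"
    using e' e(2) f(2) G'(1) F(1) by (auto simp: subgraph_def)
  moreover have "f ` verts ?X \<subseteq> verts H"
    using im F(1) by (simp add: subgraph_def)
  ultimately have "contains H ?X"
    using inj contains_iff_embedding[OF sX H] by auto
  with X show ?R by blast
next
  assume ?R
  then obtain X F where X: "X \<in> edge_extensions G"
    and F: "subgraph F H" "graph_isomorphic X F"
    unfolding contains_def by blast
  obtain e where e: "e \<in> nsets (verts G) 2" "e \<notin> edges G" "verts X = verts G"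
    "edges X = insert e (edges G)"
    using edge_extensionsE[OF X G] by metis
  obtain f where f: "bij_betw f (verts G) (verts F)"
    "edges F = (\<lambda>e. f ` e) ` insert e (edges G)"
    using F(2) e(3,4) by (auto simp: graph_isomorphic_def)
  let ?G' = "Graph (verts F) ((\<lambda>e. f ` e) ` edges G)"
  have inj: "inj_on (\<lambda>e. f ` e) (Pow (verts G))"
    using f(1) by (simp add: bij_betw_def inj_on_image_Pow)
  have "e \<in> Pow (verts G)" "edges G \<subseteq> Pow (verts G)"
    using e(1) G by (auto simp: nsets_def simple_graph_def)
  then have "f ` e \<notin> edges ?G'"
    using inj_on_image_mem_iff[OF inj] e(2) by simp
  then have "?G' \<noteq> F"
    using f(2) by (metis image_insert insertI1)
  moreover have "subgraph ?G' F"
    using F(1) f(2) by (auto simp: subgraph_def simple_graph_def)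
  moreover have "graph_isomorphic G ?G'"
    using f(1) by (auto simp: graph_isomorphic_def)
  ultimately have "contains_properly F G"
    unfolding contains_properly_def by blast
  then show ?L
    using F(1) bij_betw_same_card[OF f(1)] by metis
qed

lemma not_contains_edgeless:
  assumes "edges H = {}" "edges G \<noteq> {}"
  shows "\<not> contains H G"
  using assms by (auto simp: contains_def subgraph_def graph_isomorphic_def)

text \<open>
  The hypothesis that the members of \<open>\<F>\<close> have edges makes the maximum defining \<open>ex(n,\<F>)\<close>
  range over a nonempty set; no such condition on \<open>\<G>\<close> is needed, since the second hypothesis
  makes every \<open>\<F>\<close>-free host graph \<open>\<G>\<close>-free.
\<close>
lemma ex_family_mono:
  fixes \<F> :: "'a graph set" and \<G> :: "'b graph set"
  assumes ne: "\<And>G. G \<in> \<F> \<Longrightarrow> edges G \<noteq> {}"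
    and imp: "\<And>(H :: nat graph) G. simple_graph H \<Longrightarrow> G \<in> \<G> \<Longrightarrow> contains H G \<Longrightarrow>
      \<exists>G'\<in>\<F>. contains H G'"
  shows "ex_family n \<F> \<le> ex_family n \<G>"
  unfolding ex_family_def
proof (rule Max_mono)
  show "{card (edges H) |H :: nat graph. simple_graph H \<and> card (verts H) = n \<and>
      (\<forall>G\<in>\<F>. \<not> contains H G)} \<subseteq>
    {card (edges H) |H :: nat graph. simple_graph H \<and> card (verts H) = n \<and>
      (\<forall>G\<in>\<G>. \<not> contains H G)}"
    using imp by blast
  let ?E = "Graph {..<n} {} :: nat graph"
  have "simple_graph ?E \<and> card (verts ?E) = n \<and> (\<forall>G\<in>\<F>. \<not> contains ?E G)"
    using ne by (auto simp: simple_graph_def not_contains_edgeless)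
  then show "{card (edges H) |H :: nat graph. simple_graph H \<and> card (verts H) = n \<and>
      (\<forall>G\<in>\<F>. \<not> contains H G)} \<noteq> {}"
    by blast
  show "finite {card (edges H) |H :: nat graph. simple_graph H \<and> card (verts H) = n \<and>
      (\<forall>G\<in>\<G>. \<not> contains H G)}"
    by (rule finite_subset[of _ "{..n choose 2}"]) (auto dest: simple_graph_card_edges_le)
qed

lemma st_eq_ex_family_edge_extensions:
  assumes "simple_graph G"
  shows "st n G = ex_family n (edge_extensions G)"
proof -
  have "{card (edges H) |H :: nat graph. simple_graph H \<and> card (verts H) = n \<and>
      \<not> (\<exists>F. subgraph F H \<and> card (verts F) = card (verts G) \<and> contains_properly F G)} =
    {card (edges H) |H :: nat graph. simple_graph H \<and> card (verts H) = n \<and>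
      (\<forall>X\<in>edge_extensions G. \<not> contains H X)}"
    using proper_containment_iff_contains_extension[OF assms] by blast
  then show ?thesis
    unfolding st_def ex_family_def by (rule arg_cong)
qed

lemma finite_edge_extensions:
  assumes "simple_graph G"
  shows "finite (edge_extensions G)"
proof -
  have "edge_extensions G =
    (\<lambda>e. Graph (verts G) (insert e (edges G))) ` (nsets (verts G) 2 - edges G)"
    unfolding edge_extensions_def by blast
  then show ?thesis
    using assms by (simp add: simple_graph_def finite_imp_finite_nsets)
qed

lemma edge_extensions_nonempty:
  assumes "simple_graph G" "\<not> complete_graph G"
  shows "edge_extensions G \<noteq> {}"
  using assms unfolding edge_extensions_def complete_graph_def simple_graph_def by blast

theorem lemma1:
  fixes G :: "'a graph" and n :: nat
  assumes "simple_graph G"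
    and "\<not> complete_graph G"
    and "n \<ge> card (verts G)"
  shows "(edges G \<noteq> {} \<longrightarrow> ex_graph n G \<le> st n G)
    \<and> st n G = ex_family n (edge_extensions G)
    \<and> ex_family n (edge_extensions G) \<le> Min {ex_graph n H | H. H \<in> edge_extensions G}"
proof (intro conjI impI)
  show eq: "st n G = ex_family n (edge_extensions G)"
    by (rule st_eq_ex_family_edge_extensions[OF assms(1)])
  show "ex_graph n G \<le> st n G" if "edges G \<noteq> {}"
    unfolding eq ex_graph_def
    using that contains_extension_imp_contains[OF assms(1)] by (intro ex_family_mono) auto
  have "ex_family n (edge_extensions G) \<le> ex_graph n X" if "X \<in> edge_extensions G" for X
    unfolding ex_graph_def
    using that by (intro ex_family_mono) (auto simp: edge_extensions_def)
  moreover have "finite {ex_graph n H | H. H \<in> edge_extensions G}"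
    using finite_edge_extensions[OF assms(1)] by simp
  ultimately show "ex_family n (edge_extensions G) \<le>
      Min {ex_graph n H | H. H \<in> edge_extensions G}"
    using edge_extensions_nonempty[OF assms(1,2)] by (subst Min_ge_iff) auto
qed

end
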